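(* Let $K=2$, let $-1<\ell\le u<1$, and for $\rho\in[\ell,u]$ let $M_\rho=\begin{pmatrix}1&\rho\\ \rho&1\end{pmatrix}$. Fix $\alpha\in(0,1)$ and let $c(\rho)$ denote the $1-\alpha$ quantile, $c(\rho)=\inf\{c:\mathbb{P}\{\bar\chi^2(M_\rho^{-1},\Lambda_+)\le c\}\ge1-\alpha\}$. Then $c(\ell)\ge c(\rho)$ for every $\rho\in[\ell,u]$; i.e., the most conservative (largest) $1-\alpha$ quantile over this set of correlation matrices is attained at $\rho=\ell$.
   Context: $\Lambda_+=\{\lambda\in\mathbb{R}^2:\lambda_1\ge0,\lambda_2\ge0,\ \lambda_1+\lambda_2>0\}$. For a positive definite $2\times2$ matrix $V$, the chi-bar-squared distribution $\bar\chi^2(V,\Lambda_+)$ is the law of $X^TV^{-1}X-\inf_{\theta\in\Lambda_+}(X-\theta)^TV^{-1}(X-\theta)$ where $X\sim N_2(0,V)$. *)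

theory Defs
  imports "HOL-Analysis.Analysis"
begin

text \<open>The cone Lambda_+ in R^2.\<close>
definition Lambda_plus :: "(real^2) set" where
  "Lambda_plus = {\<theta>. \<theta>$1 \<ge> 0 \<and> \<theta>$2 \<ge> 0 \<and> \<theta>$1 + \<theta>$2 > 0}"

text \<open>Quadratic form y^T A y.\<close>
definition qform :: "real^2^2 \<Rightarrow> real^2 \<Rightarrow> real" where
  "qform A y = y \<bullet> (A *v y)"

text \<open>The chi-bar-squared statistic for covariance V evaluated at X = x.\<close>
definition chibar_stat :: "real^2^2 \<Rightarrow> real^2 \<Rightarrow> real" where
  "chibar_stat V x = qform (matrix_inv V) x
      - (INF \<theta>\<in>Lambda_plus. qform (matrix_inv V) (x - \<theta>))"

text \<open>Density of the centred bivariate normal N_2(0,V) w.r.t. Lebesgue measure.\<close>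
definition gauss2_density :: "real^2^2 \<Rightarrow> real^2 \<Rightarrow> real" where
  "gauss2_density V x = exp (- qform (matrix_inv V) x / 2) / (2 * pi * sqrt (det V))"

definition gauss2 :: "real^2^2 \<Rightarrow> (real^2) measure" where
  "gauss2 V = density lborel (\<lambda>x. ennreal (gauss2_density V x))"

text \<open>CDF of the chi-bar-squared distribution: P{chibar^2(V,Lambda_+) <= c}.\<close>
definition chibar_cdf :: "real^2^2 \<Rightarrow> real \<Rightarrow> real" where
  "chibar_cdf V c = measure (gauss2 V) {x. chibar_stat V x \<le> c}"

text \<open>The (1 - alpha) quantile.\<close>
definition chibar_quantile :: "real^2^2 \<Rightarrow> real \<Rightarrow> real" where
  "chibar_quantile V \<alpha> = Inf {c. chibar_cdf V c \<ge> 1 - \<alpha>}"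

text \<open>Correlation matrix M_rho.\<close>
definition corr_mat :: "real \<Rightarrow> real^2^2" where
  "corr_mat \<rho> = vector [vector [1, \<rho>], vector [\<rho>, 1]]"

end

theory Submission
  imports Defs "HOL-Probability.Probability"
begin

text \<open>
  Write \<open>M\<^sub>\<rho> = L\<^sub>\<rho>\<^sup>T L\<^sub>\<rho>\<close> with the upper triangular Cholesky factor \<open>L\<^sub>\<rho>\<close>.
  If \<open>X \<sim> N(0, M\<^sub>\<rho>\<^sup>-\<^sup>1)\<close> then \<open>Y = L\<^sub>\<rho> X\<close> is standard normal, and the
  statistic becomes \<open>|Y|\<^sup>2 - d(Y, C\<^sub>\<rho>)\<^sup>2\<close>, where \<open>C\<^sub>\<rho> = L\<^sub>\<rho> \<Lambda>\<^sub>+\<close> is the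
  cone spanned by \<open>(1, 0)\<close> and \<open>(\<rho>, sqrt (1 - \<rho>\<^sup>2))\<close>, of opening angle
  \<open>arccos \<rho>\<close>. For \<open>l \<le> \<rho>\<close> the cone \<open>C\<^sub>l\<close> contains \<open>C\<^sub>\<rho>\<close>, so on the common
  standard normal space the statistic for \<open>l\<close> dominates the one for \<open>\<rho>\<close>
  pointwise. Hence the distribution function for \<open>l\<close> lies below the one for
  \<open>\<rho>\<close>, and its quantiles lie above.
\<close>

lemma matrix_inv_invertible:
  fixes A :: "'a::semiring_1^'n^'m"
  assumes "invertible A"
  shows "A ** matrix_inv A = mat 1" and "matrix_inv A ** A = mat 1"
  using someI_ex[OF assms[unfolded invertible_def]] by (simp_all add: matrix_inv_def)

lemma matrix_inv_eqI:
  fixes A B :: "'a::semiring_1^'n^'n"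
  assumes "A ** B = mat 1" and "B ** A = mat 1"
  shows "matrix_inv A = B"
proof -
  have inv: "invertible A" using assms unfolding invertible_def by blast
  have "matrix_inv A = (B ** A) ** matrix_inv A" by (simp add: assms(2))
  also have "\<dots> = B" by (simp add: matrix_mul_assoc[symmetric] matrix_inv_invertible[OF inv])
  finally show ?thesis .
qed

lemma invertible_matrix_inv:
  fixes A :: "'a::semiring_1^'n^'n"
  assumes "invertible A"
  shows "invertible (matrix_inv A)" and "matrix_inv (matrix_inv A) = A"
  using matrix_inv_invertible[OF assms] unfolding invertible_def
  by (blast, intro matrix_inv_eqI)

lemma det_matrix_inv:
  fixes A :: "'a::field^'n^'n"
  assumes "invertible A"
  shows "det A * det (matrix_inv A) = 1"
  using arg_cong[OF matrix_inv_invertible(1)[OF assms], of det] by (simp add: det_mul)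

lemma matrix_inv_mat1 [simp]: "matrix_inv (mat 1 :: 'a::semiring_1^'n^'n) = mat 1"
  by (rule matrix_inv_eqI) simp_all

lemma qform_transpose_mult: "qform (transpose L ** L) x = (norm (L *v x))\<^sup>2"
  by (simp add: qform_def power2_norm_eq_inner matrix_vector_mul_assoc[symmetric]
      dot_lmul_matrix[symmetric] inner_commute)

lemma qform_mat1: "qform (mat 1) y = (norm y)\<^sup>2"
  using qform_transpose_mult[of "mat 1" y] by simp

lemma nn_integral_lborel_linear_change:
  fixes B :: "real^('n::{finite,wellorder})^('n::{finite,wellorder})"
    and h :: "real^('n::{finite,wellorder}) \<Rightarrow> real"
  assumes "surj ((*v) B)" and h: "h \<in> borel_measurable borel" "\<And>y. 0 \<le> h y"
    and fin: "(\<integral>\<^sup>+y. h y \<partial>lborel) < \<infinity>"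
  shows "(\<integral>\<^sup>+x. ennreal (\<bar>det B\<bar> * h (B *v x)) \<partial>lborel) = (\<integral>\<^sup>+y. h y \<partial>lborel)"
proof -
  obtain r where r: "(\<integral>\<^sup>+y. h y \<partial>lborel) = ennreal r" "0 \<le> r"
    using fin by (cases "\<integral>\<^sup>+y. h y \<partial>lborel" rule: ennreal_cases) auto
  have "(h has_integral r) UNIV"
    by (rule nn_integral_has_integral[OF h r])
  moreover have "h absolutely_integrable_on UNIV"
    using calculation h(2) by (intro nonnegative_absolutely_integrable_1) auto
  ultimately have "(\<lambda>y. vec (h y) :: real^1) absolutely_integrable_on (*v) B ` UNIV
      \<and> integral ((*v) B ` UNIV) (\<lambda>y. vec (h y)) = (vec r :: real^1)"
    using assms(1) by (simp add: absolutely_integrable_on_1_iff integral_on_1_eq integral_unique)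
  then have "(\<lambda>x. \<bar>det B\<bar> *\<^sub>R vec (h (B *v x)) :: real^1) absolutely_integrable_on UNIV
      \<and> integral UNIV (\<lambda>x. \<bar>det B\<bar> *\<^sub>R vec (h (B *v x))) = (vec r :: real^1)"
    using has_absolute_integral_change_of_variables_linear[OF matrix_vector_mul_linear[of B],
        where f = "\<lambda>y. vec (h y)" and S = UNIV and b = "vec r"]
    by (simp only: matrix_of_matrix_vector_mul) blast
  then have "((\<lambda>x. \<bar>det B\<bar> * h (B *v x)) has_integral r) UNIV"
    by (simp add: absolutely_integrable_on_1_iff integral_on_1_eq absolutely_integrable_on_def
        has_integral_iff vec_eq_iff)
  moreover have "(\<lambda>x. \<bar>det B\<bar> * h (B *v x)) \<in> borel_measurable borel"
    by (intro borel_measurable_times borel_measurable_const measurable_compose[OF _ h(1)]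
        borel_measurable_continuous_onI matrix_vector_mult_linear_continuous_on)
  ultimately have "(\<integral>\<^sup>+x. ennreal (\<bar>det B\<bar> * h (B *v x)) \<partial>lborel) = r"
    using h(2) by (intro nn_integral_has_integral_lborel) auto
  then show ?thesis using r by simp
qed

lemma power2_infdist:
  fixes y :: "'a::metric_space"
  assumes "S \<noteq> {}"
  shows "(infdist y S)\<^sup>2 = (INF s\<in>S. (dist y s)\<^sup>2)"
proof -
  define f :: "real \<Rightarrow> real" where "f d = (max 0 d)\<^sup>2" for d
  have "mono f"
    unfolding f_def by (intro monoI power_mono) auto
  moreover have "continuous (at_right (infdist y S)) f"
    unfolding f_def by (intro continuous_intros)
  ultimately have "f (Inf (dist y ` S)) = (INF d\<in>dist y ` S. f d)"
    using assms by (intro continuous_at_Inf_mono) (auto simp: infdist_notempty bdd_below_def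
        intro: zero_le_dist)
  then show ?thesis
    using assms by (simp add: f_def image_image infdist_nonneg infdist_notempty[symmetric])
qed

lemma quantile_antimono:
  assumes M: "real_distribution M" and N: "real_distribution N"
    and le: "\<And>c. cdf M c \<le> cdf N c" and p: "0 < p" "p < 1"
  shows "Inf {c. p \<le> cdf N c} \<le> Inf {c. p \<le> cdf M c}"
proof (rule cInf_superset_mono)
  have "\<forall>\<^sub>F c in at_top. p < cdf M c"
    using real_distribution.cdf_lim_at_top_prob[OF M] p(2) by (rule order_tendstoD)
  then show "{c. p \<le> cdf M c} \<noteq> {}"
    by (auto simp: eventually_at_top_linorder dest: less_imp_le)
  have "\<forall>\<^sub>F c in at_bot. cdf N c < p"
    using finite_borel_measure.cdf_lim_at_bot[OF real_distribution.finite_borel_measure_M[OF N]] p(1)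
    by (rule order_tendstoD)
  then obtain c0 where "\<And>c. c \<le> c0 \<Longrightarrow> cdf N c < p"
    by (auto simp: eventually_at_bot_linorder)
  then show "bdd_below {c. p \<le> cdf N c}"
    by (intro bdd_belowI[of _ c0]) (metis le_cases mem_Collect_eq not_le)
  show "{c. p \<le> cdf M c} \<subseteq> {c. p \<le> cdf N c}"
    using le by (auto intro: order_trans)
qed

lemma gauss2_density_mat1: "gauss2_density (mat 1) y = exp (- (norm y)\<^sup>2 / 2) / (2 * pi)"
  by (simp add: gauss2_density_def qform_mat1)

lemma gauss2_density_mat1_prod:
  "gauss2_density (mat 1) y = (\<Prod>b\<in>Basis. std_normal_density (y \<bullet> b))"
proof -
  have "(norm y)\<^sup>2 = (\<Sum>b\<in>Basis. (y \<bullet> b)\<^sup>2)"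
    unfolding power2_norm_eq_inner by (subst euclidean_inner) (simp add: power2_eq_square)
  moreover have "(\<Prod>b\<in>(Basis :: (real^2) set). sqrt (2 * pi)) = 2 * pi"
    by simp
  ultimately show ?thesis
    by (simp add: gauss2_density_mat1 std_normal_density_def prod_dividef exp_sum sum_divide_distrib
        sum_negf[symmetric])
qed

lemma nn_integral_gauss2_density_mat1: "(\<integral>\<^sup>+y. ennreal (gauss2_density (mat 1) y) \<partial>lborel) = 1"
proof -
  have "prob_space (density lborel (\<lambda>x. ennreal (std_normal_density x)))"
    by (rule prob_space_normal_density) simp
  then have std: "(\<integral>\<^sup>+x. ennreal (std_normal_density x) \<partial>lborel) = 1"
    using prob_space.emeasure_space_1 by (fastforce simp: emeasure_density)
  have "(\<integral>\<^sup>+y. ennreal (gauss2_density (mat 1) y) \<partial>lborel)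
      = (\<integral>\<^sup>+y. (\<Prod>b\<in>(Basis :: (real^2) set). ennreal (std_normal_density (y \<bullet> b))) \<partial>lborel)"
    by (simp add: gauss2_density_mat1_prod prod_ennreal)
  also have "\<dots> = 1"
    by (subst nn_integral_lborel_prod) (simp_all add: std)
  finally show ?thesis .
qed

lemma borel_measurable_gauss2_density_mat1: "gauss2_density (mat 1) \<in> borel_measurable borel"
proof (rule borel_measurable_continuous_onI)
  show "continuous_on UNIV (gauss2_density (mat 1))"
    unfolding gauss2_density_mat1[abs_def] by (intro continuous_intros) simp_all
qed

lemma prob_space_gauss2_mat1: "prob_space (gauss2 (mat 1))"
proof
  have "emeasure (gauss2 (mat 1)) UNIV = 1"
    unfolding gauss2_def
    using borel_measurable_gauss2_density_mat1
    by (subst emeasure_density) (simp_all add: nn_integral_gauss2_density_mat1)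
  then show "emeasure (gauss2 (mat 1)) (space (gauss2 (mat 1))) = 1"
    by (simp add: gauss2_def)
qed

lemma det_whitening:
  fixes V L :: "real^'n^'n"
  assumes "invertible V" and "matrix_inv V = transpose L ** L"
  shows "det V * (det L)\<^sup>2 = 1"
  using det_matrix_inv[OF assms(1)] by (simp add: assms(2) det_mul power2_eq_square)

lemma whitening_factor_inverse:
  fixes V L :: "real^'n^'n"
  assumes "invertible V" and "matrix_inv V = transpose L ** L"
  shows "L *v (matrix_inv L *v y) = y" and "matrix_inv L *v (L *v x) = x"
proof -
  have "invertible L"
    using det_whitening[OF assms] by (auto simp: invertible_det_nz)
  then show "L *v (matrix_inv L *v y) = y" and "matrix_inv L *v (L *v x) = x"
    by (simp_all add: matrix_vector_mul_assoc matrix_inv_invertible)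
qed

lemma gauss2_density_whitened:
  fixes V L :: "real^2^2"
  assumes "invertible V" and "matrix_inv V = transpose L ** L"
  shows "gauss2_density V x = \<bar>det L\<bar> * gauss2_density (mat 1) (L *v x)"
proof -
  have "sqrt (det V) * \<bar>det L\<bar> = 1"
    using det_whitening[OF assms] by (metis real_sqrt_abs real_sqrt_mult real_sqrt_one)
  then have "sqrt (det V) = 1 / \<bar>det L\<bar>"
    by (metis nonzero_eq_divide_eq mult_zero_right zero_neq_one)
  then show ?thesis
    by (simp add: gauss2_density_def qform_mat1 assms(2) qform_transpose_mult)
qed

lemma gauss2_eq_distr_whitened:
  fixes V L :: "real^2^2"
  assumes "invertible V" and "matrix_inv V = transpose L ** L"
  shows "gauss2 V = distr (gauss2 (mat 1)) borel ((*v) (matrix_inv L))"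
proof (rule measure_eqI)
  show "sets (gauss2 V) = sets (distr (gauss2 (mat 1)) borel ((*v) (matrix_inv L)))"
    by (simp add: gauss2_def)
  note inv = whitening_factor_inverse[OF assms]
  have lin_meas: "(*v) M \<in> borel_measurable borel" for M :: "real^2^2"
    by (intro borel_measurable_continuous_onI matrix_vector_mult_linear_continuous_on)
  fix E assume "E \<in> sets (gauss2 V)"
  then have E: "E \<in> sets borel" by (simp add: gauss2_def)
  have pre: "(*v) (matrix_inv L) -` E \<in> sets borel"
    using measurable_sets[OF lin_meas E] by simp
  define h where "h y = gauss2_density (mat 1) y * indicator E (matrix_inv L *v y)" for y
  have h_meas: "h \<in> borel_measurable borel"
    unfolding h_def using pre
    by (intro borel_measurable_times borel_measurable_gauss2_density_mat1
        borel_measurable_indicator') (auto simp: vimage_def)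
  have h_nonneg: "0 \<le> h y" for y
    by (simp add: h_def gauss2_density_mat1)
  have "(\<integral>\<^sup>+y. h y \<partial>lborel) \<le> (\<integral>\<^sup>+y. ennreal (gauss2_density (mat 1) y) \<partial>lborel)"
    by (intro nn_integral_mono) (auto simp: h_def indicator_def gauss2_density_mat1)
  then have h_fin: "(\<integral>\<^sup>+y. h y \<partial>lborel) < \<infinity>"
    by (simp add: nn_integral_gauss2_density_mat1 order_le_less_trans)
  have dens_meas: "(\<lambda>x. ennreal (gauss2_density V x)) \<in> borel_measurable borel"
    unfolding gauss2_density_whitened[OF assms]
    by (intro measurable_compose[OF _ measurable_ennreal] borel_measurable_times
        borel_measurable_const measurable_compose[OF lin_meas borel_measurable_gauss2_density_mat1])
  have "emeasure (gauss2 V) E = (\<integral>\<^sup>+x. ennreal (gauss2_density V x) * indicator E x \<partial>lborel)"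
    unfolding gauss2_def using dens_meas E by (simp add: emeasure_density)
  also have "\<dots> = (\<integral>\<^sup>+x. ennreal (\<bar>det L\<bar> * h (L *v x)) \<partial>lborel)"
    by (intro nn_integral_cong)
      (simp add: h_def inv gauss2_density_whitened[OF assms] split: split_indicator)
  also have "\<dots> = (\<integral>\<^sup>+y. h y \<partial>lborel)"
    using inv(1) by (intro nn_integral_lborel_linear_change h_meas h_nonneg h_fin) (metis surjI)
  also have "\<dots> = emeasure (gauss2 (mat 1)) ((*v) (matrix_inv L) -` E)"
    unfolding gauss2_def using borel_measurable_gauss2_density_mat1 pre
    by (subst emeasure_density)
      (auto simp: h_def gauss2_density_mat1 intro!: nn_integral_cong split: split_indicator)
  also have "\<dots> = emeasure (distr (gauss2 (mat 1)) borel ((*v) (matrix_inv L))) E"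
    using E lin_meas by (subst emeasure_distr) (simp_all add: gauss2_def)
  finally show "emeasure (gauss2 V) E
      = emeasure (distr (gauss2 (mat 1)) borel ((*v) (matrix_inv L))) E" .
qed

lemma Lambda_plus_nonempty: "Lambda_plus \<noteq> {}"
proof -
  have "vector [1, 0] \<in> Lambda_plus" by (simp add: Lambda_plus_def)
  then show ?thesis by blast
qed

lemma chibar_stat_whitened:
  fixes V L :: "real^2^2"
  assumes "matrix_inv V = transpose L ** L"
  shows "chibar_stat V x = (norm (L *v x))\<^sup>2 - (infdist (L *v x) ((*v) L ` Lambda_plus))\<^sup>2"
  using Lambda_plus_nonempty
  by (simp add: chibar_stat_def assms qform_transpose_mult power2_infdist image_image dist_norm
      matrix_vector_mult_diff_distrib)

lemma continuous_on_chibar_stat: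
  fixes V L :: "real^2^2"
  assumes "matrix_inv V = transpose L ** L"
  shows "continuous_on UNIV (chibar_stat V)"
  unfolding chibar_stat_whitened[OF assms, abs_def]
  by (intro continuous_intros matrix_vector_mult_linear_continuous_on)

lemma chibar_cdf_whitened:
  fixes V L :: "real^2^2"
  assumes "invertible V" and "matrix_inv V = transpose L ** L"
  shows "chibar_cdf V c =
    measure (gauss2 (mat 1)) {y. (norm y)\<^sup>2 - (infdist y ((*v) L ` Lambda_plus))\<^sup>2 \<le> c}"
proof -
  have "closed {x. chibar_stat V x \<le> c}"
    by (intro closed_Collect_le continuous_on_chibar_stat[OF assms(2)] continuous_on_const)
  then show ?thesis
    unfolding chibar_cdf_def gauss2_eq_distr_whitened[OF assms]
    by (subst measure_distr)
      (auto simp: gauss2_def chibar_stat_whitened[OF assms(2)] whitening_factor_inverse[OF assms]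
        intro: borel_measurable_continuous_onI matrix_vector_mult_linear_continuous_on)
qed

lemma chibar_law_whitened:
  fixes V L :: "real^2^2"
  assumes "invertible V" and "matrix_inv V = transpose L ** L"
  shows "real_distribution (distr (gauss2 V) borel (chibar_stat V))"
    and "chibar_cdf V = cdf (distr (gauss2 V) borel (chibar_stat V))"
proof -
  have meas: "chibar_stat V \<in> gauss2 V \<rightarrow>\<^sub>M borel"
    using continuous_on_chibar_stat[OF assms(2)]
    by (simp add: gauss2_def borel_measurable_continuous_onI)
  have "prob_space (gauss2 V)"
    unfolding gauss2_eq_distr_whitened[OF assms]
    by (intro prob_space.prob_space_distr prob_space_gauss2_mat1)
      (simp add: gauss2_def borel_measurable_continuous_onI matrix_vector_mult_linear_continuous_on)
  then show "real_distribution (distr (gauss2 V) borel (chibar_stat V))"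
    using meas by (rule prob_space.real_distribution_distr)
  show "chibar_cdf V = cdf (distr (gauss2 V) borel (chibar_stat V))"
    using meas by (auto simp: fun_eq_iff chibar_cdf_def cdf_def measure_distr gauss2_def vimage_def)
qed

definition corr_factor :: "real \<Rightarrow> real^2^2" where
  "corr_factor \<rho> = vector [vector [1, \<rho>], vector [0, sqrt (1 - \<rho>\<^sup>2)]]"

lemma corr_factor_apply:
  "(corr_factor \<rho> *v x)$1 = x$1 + \<rho> * x$2"
  "(corr_factor \<rho> *v x)$2 = sqrt (1 - \<rho>\<^sup>2) * x$2"
  by (simp_all add: corr_factor_def matrix_vector_mult_def sum_2)

lemma corr_mat_eq_transpose_mult:
  assumes "\<bar>\<rho>\<bar> \<le> 1"
  shows "corr_mat \<rho> = transpose (corr_factor \<rho>) ** corr_factor \<rho>"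
proof -
  have "\<rho>\<^sup>2 \<le> 1" using assms by (simp add: abs_square_le_1)
  then have "\<rho> * \<rho> + (sqrt (1 - \<rho>\<^sup>2))\<^sup>2 = 1" by (simp add: power2_eq_square)
  then show ?thesis
    by (simp add: vec_eq_iff forall_2 corr_mat_def corr_factor_def matrix_matrix_mult_def
        transpose_def sum_2 power2_eq_square)
qed

lemma invertible_corr_mat:
  assumes "\<bar>\<rho>\<bar> < 1"
  shows "invertible (corr_mat \<rho>)"
proof -
  have "\<rho>\<^sup>2 < 1" using assms by (simp add: abs_square_less_1)
  then show ?thesis by (simp add: invertible_det_nz det_2 corr_mat_def power2_eq_square)
qed

lemma whitening_corr_mat:
  assumes "\<bar>\<rho>\<bar> < 1"
  shows "invertible (matrix_inv (corr_mat \<rho>))"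
    and "matrix_inv (matrix_inv (corr_mat \<rho>)) = transpose (corr_factor \<rho>) ** corr_factor \<rho>"
  using invertible_matrix_inv[OF invertible_corr_mat[OF assms]] corr_mat_eq_transpose_mult assms
  by auto

text \<open>Monotonicity of \<open>\<rho> / sqrt (1 - \<rho>\<^sup>2) = cot (arccos \<rho>)\<close>, stated without division.\<close>

lemma mult_sqrt_one_minus_power2_le:
  fixes l r :: real
  assumes "l \<le> r" and "\<bar>l\<bar> \<le> 1" and "\<bar>r\<bar> \<le> 1"
  shows "l * sqrt (1 - r\<^sup>2) \<le> r * sqrt (1 - l\<^sup>2)"
proof -
  have mono: "\<bar>a\<bar> * sqrt (1 - b\<^sup>2) \<le> \<bar>b\<bar> * sqrt (1 - a\<^sup>2)" if "a\<^sup>2 \<le> b\<^sup>2" for a b :: real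
  proof -
    have "sqrt (a\<^sup>2 * (1 - b\<^sup>2)) \<le> sqrt (b\<^sup>2 * (1 - a\<^sup>2))"
      using that by (simp add: algebra_simps)
    then show ?thesis by (simp add: real_sqrt_mult)
  qed
  consider "l \<le> 0" "0 \<le> r" | "0 < l" | "r < 0" by linarith
  then show ?thesis
  proof cases
    case 1
    have "0 \<le> 1 - l\<^sup>2" "0 \<le> 1 - r\<^sup>2"
      using assms by (simp_all add: abs_square_le_1)
    then show ?thesis
      using 1 by (meson mult_nonneg_nonneg mult_nonpos_nonneg order_trans real_sqrt_ge_zero)
  next
    case 2
    then have "l\<^sup>2 \<le> r\<^sup>2" using assms by (simp add: power_mono)
    then show ?thesis using mono[of l r] 2 assms by simp
  next
    case 3
    then have "(- r)\<^sup>2 \<le> (- l)\<^sup>2" using assms by (intro power_mono) auto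
    then show ?thesis using mono[of r l] 3 assms by simp
  qed
qed

lemma corr_factor_cone_antimono:
  assumes "-1 < l" and "l \<le> r" and "r < 1"
  shows "(*v) (corr_factor r) ` Lambda_plus \<subseteq> (*v) (corr_factor l) ` Lambda_plus"
proof
  fix p assume "p \<in> (*v) (corr_factor r) ` Lambda_plus"
  then obtain t where t: "t \<in> Lambda_plus" and p: "p = corr_factor r *v t" by blast
  have sl: "sqrt (1 - l\<^sup>2) > 0" and sr: "sqrt (1 - r\<^sup>2) > 0"
    using assms by (simp_all add: abs_square_less_1)
  \<comment> \<open>coordinates of \<open>p\<close> with respect to the generators of the larger cone\<close>
  define b where "b = sqrt (1 - r\<^sup>2) * t$2 / sqrt (1 - l\<^sup>2)"
  define a where "a = t$1 + r * t$2 - l * b"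
  have t1: "t$1 \<ge> 0" and t2: "t$2 \<ge> 0" and t12: "t$1 + t$2 > 0"
    using t by (auto simp: Lambda_plus_def)
  have "l * b = t$2 * (l * sqrt (1 - r\<^sup>2)) / sqrt (1 - l\<^sup>2)"
    by (simp add: b_def)
  also have "\<dots> \<le> t$2 * (r * sqrt (1 - l\<^sup>2)) / sqrt (1 - l\<^sup>2)"
    using mult_sqrt_one_minus_power2_le[of l r] assms t2 sl
    by (intro divide_right_mono mult_left_mono) auto
  finally have "l * b \<le> r * t$2" using sl by (simp add: mult.commute)
  then have "a \<ge> 0" using t1 by (simp add: a_def)
  moreover have "b \<ge> 0" and "t$2 > 0 \<Longrightarrow> b > 0"
    using sl sr t2 by (simp_all add: b_def)
  moreover have "b = 0 \<Longrightarrow> a = t$1"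
    using sl sr by (simp add: a_def b_def)
  ultimately have "vector [a, b] \<in> Lambda_plus"
    using t12 by (fastforce simp: Lambda_plus_def)
  moreover have "corr_factor l *v vector [a, b] = p"
    using sl by (simp add: vec_eq_iff forall_2 p corr_factor_apply a_def b_def)
  ultimately show "p \<in> (*v) (corr_factor l) ` Lambda_plus" by blast
qed

lemma chibar_cdf_corr_mono:
  assumes "-1 < l" and "l \<le> r" and "r < 1"
  shows "chibar_cdf (matrix_inv (corr_mat l)) c \<le> chibar_cdf (matrix_inv (corr_mat r)) c"
proof -
  define E where "E \<rho> = {y. (norm y)\<^sup>2 - (infdist y ((*v) (corr_factor \<rho>) ` Lambda_plus))\<^sup>2 \<le> c}"
    for \<rho>
  have "(infdist y ((*v) (corr_factor l) ` Lambda_plus))\<^sup>2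
      \<le> (infdist y ((*v) (corr_factor r) ` Lambda_plus))\<^sup>2" for y
    using corr_factor_cone_antimono[OF assms] Lambda_plus_nonempty
    by (intro power_mono infdist_mono infdist_nonneg) auto
  then have sub: "E l \<subseteq> E r"
    unfolding E_def by (smt (verit) mem_Collect_eq subsetI)
  have "closed (E r)"
    unfolding E_def by (intro closed_Collect_le continuous_intros)
  then have "measure (gauss2 (mat 1)) (E l) \<le> measure (gauss2 (mat 1)) (E r)"
    using sub prob_space.axioms(1)[OF prob_space_gauss2_mat1]
    by (intro finite_measure.finite_measure_mono) (auto simp: gauss2_def)
  then show ?thesis
    using assms by (simp add: chibar_cdf_whitened[OF whitening_corr_mat] E_def)
qed

theorem mainTheorem8:
  fixes l u \<alpha> \<rho> :: real
  assumes "-1 < l" and "l \<le> u" and "u < 1"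
    and "0 < \<alpha>" and "\<alpha> < 1"
    and "\<rho> \<in> {l..u}"
  shows "chibar_quantile (matrix_inv (corr_mat l)) \<alpha>
           \<ge> chibar_quantile (matrix_inv (corr_mat \<rho>)) \<alpha>"
proof -
  have "\<bar>l\<bar> < 1" and "\<bar>\<rho>\<bar> < 1" using assms by auto
  note law_l = chibar_law_whitened[OF whitening_corr_mat[OF \<open>\<bar>l\<bar> < 1\<close>]]
  note law_\<rho> = chibar_law_whitened[OF whitening_corr_mat[OF \<open>\<bar>\<rho>\<bar> < 1\<close>]]
  have "chibar_cdf (matrix_inv (corr_mat l)) c \<le> chibar_cdf (matrix_inv (corr_mat \<rho>)) c" for c
    using assms by (intro chibar_cdf_corr_mono) auto
  then show ?thesis
    unfolding chibar_quantile_def law_l(2) law_\<rho>(2)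
    using assms by (intro quantile_antimono law_l(1) law_\<rho>(1)) (simp_all add: law_l(2) law_\<rho>(2))
qed

end
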